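(* The Scarf economy $(3,z^{\mathrm{scarf}})$ is a balanced economy that satisfies Walras' law, i.e., for all $p\in\mathbb R^3_+$, it holds that $p\cdot z^{\mathrm{scarf}}(p)=0$. Furthermore, the set of Walrasian equilibria of the Scarf economy is $\{\lambda(1,1,1):\lambda>0\}$.
   Context: The Scarf economy $(3,z^{\mathrm{scarf}})$ has three goods and excess demand function $$z^{\mathrm{scarf}}(p)=\left(\tfrac{p_1}{p_1+p_2}+\tfrac{p_3}{p_1+p_3}-1,\ \tfrac{p_1}{p_1+p_2}+\tfrac{p_2}{p_2+p_3}-1,\ \tfrac{p_2}{p_2+p_3}+\tfrac{p_3}{p_1+p_3}-1\right).$$ An economy with $m$ goods and single-valued excess demand $z:\mathbb R^m_+\to\mathbb R^m$ is balanced if $z(\lambda p)=z(p)$ for all $\lambda>0$ and $p\cdot z(p)\le0$ for all $p\in\mathbb R^m_+$. A Walrasian equilibrium is a $p\in\mathbb R^m_+$ with $z_j(p)\le0$ for all $j$ and $p\cdot z(p)=0$.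
   Formalization: Walrasian equilibria are sought only among nonnegative prices with at most one zero coordinate, since the excess demand formula is 0/0 at prices with two or more zeros; Walras' law and balancedness are stated on all of R^3_+ with x/0 = 0. *)

theory Defs
  imports "HOL-Analysis.Analysis"
begin

definition nonneg_orthant :: "(real ^ 'm) set" where
  "nonneg_orthant = {p. \<forall>j. 0 \<le> p $ j}"

definition balanced_economy :: "(real ^ 'm \<Rightarrow> real ^ 'm) \<Rightarrow> bool" where
  "balanced_economy z \<longleftrightarrow>
     (\<forall>p \<in> nonneg_orthant. \<forall>c>0. z (c *\<^sub>R p) = z p) \<and>
     (\<forall>p \<in> nonneg_orthant. p \<bullet> z p \<le> 0)"

definition walras_law :: "(real ^ 'm \<Rightarrow> real ^ 'm) \<Rightarrow> bool" where
  "walras_law z \<longleftrightarrow> (\<forall>p \<in> nonneg_orthant. p \<bullet> z p = 0)"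

text \<open>The set \<open>D\<close> collects the prices at which the formula for \<open>z\<close> is meaningful. A price at
  which excess demand is undefined is not an equilibrium, even if the total HOL function
  \<open>z\<close> happens to satisfy the two conditions there.\<close>

definition walrasian_equilibria ::
  "(real ^ 'm) set \<Rightarrow> (real ^ 'm \<Rightarrow> real ^ 'm) \<Rightarrow> (real ^ 'm) set" where
  "walrasian_equilibria D z =
     {p \<in> nonneg_orthant \<inter> D. (\<forall>j. z p $ j \<le> 0) \<and> p \<bullet> z p = 0}"

definition scarf_excess_demand :: "real ^ 3 \<Rightarrow> real ^ 3" where
  "scarf_excess_demand p = vector
     [p$1 / (p$1 + p$2) + p$3 / (p$1 + p$3) - 1,
      p$1 / (p$1 + p$2) + p$2 / (p$2 + p$3) - 1,
      p$2 / (p$2 + p$3) + p$3 / (p$1 + p$3) - 1]"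

text \<open>The Scarf formula divides by zero exactly at the nonnegative prices with two or more zero
  coordinates. There HOL's convention \<open>x / 0 = 0\<close> would produce spurious equilibria such as
  \<open>(0, 0, 0)\<close> and \<open>(0, 0, 1)\<close>. The boundary prices with a single zero coordinate remain in
  the domain. Homogeneity and Walras' law hold on the whole nonnegative orthant, whatever
  constant is chosen as the value of \<open>0 / 0\<close>, so they need no such restriction.\<close>

definition scarf_domain :: "(real ^ 3) set" where
  "scarf_domain = {p. p$1 + p$2 \<noteq> 0 \<and> p$1 + p$3 \<noteq> 0 \<and> p$2 + p$3 \<noteq> 0}"

end

theory Submission imports Defs begin

text \<open>On the domain, clearing denominators in \<open>z p \<le> 0\<close> gives \<open>p\<^sub>1 (p\<^sub>3 - p\<^sub>2) \<le> 0\<close>,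
  \<open>p\<^sub>2 (p\<^sub>1 - p\<^sub>3) \<le> 0\<close> and \<open>p\<^sub>3 (p\<^sub>2 - p\<^sub>1) \<le> 0\<close>. These three left-hand sides add up to
  zero, so all of them vanish. A vanishing price would then force a second one to vanish, which the
  domain excludes; hence all prices are positive and equal.\<close>

text \<open>A budget identity: a consumer owning one unit of the good priced \<open>x\<close> buys
  \<open>x / (x + y)\<close> units of each of two goods priced \<open>x\<close> and
  \<open>y\<close>. If \<open>x + y = 0\<close>, nonnegativity makes both prices zero, so the value
  of the quotient is irrelevant.\<close>

lemma mult_share_add:
  fixes x y :: real
  assumes "0 \<le> x" "0 \<le> y"
  shows "x * (x / (x + y)) + y * (x / (x + y)) = x"
proof -
  have "x * (x / (x + y)) + y * (x / (x + y)) = (x + y) * (x / (x + y))"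
    by (simp only: distrib_right)
  then show ?thesis
    using assms by (cases "x + y = 0") auto
qed

text \<open>Since \<open>w / (x + w) - 1 = - (x / (x + w))\<close>, the left-hand side is a
  difference of two fractions with numerator \<open>x\<close>; over the positive common denominator
  it becomes \<open>x * (w - y)\<close>.\<close>

lemma share_add_le_one_iff:
  fixes x y w :: real
  assumes "0 < x + y" "0 < x + w"
  shows "x / (x + y) + w / (x + w) - 1 \<le> 0 \<longleftrightarrow> x * (w - y) \<le> 0"
proof -
  have "w / (x + w) - 1 = - (x / (x + w))"
    using assms by (simp add: field_simps)
  then have "x / (x + y) + w / (x + w) - 1 = x / (x + y) - x / (x + w)"
    by simp
  also have "\<dots> = x * (w - y) / ((x + y) * (x + w))"
    using assms by (simp add: diff_frac_eq right_diff_distrib distrib_left)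
  finally have "x / (x + y) + w / (x + w) - 1 = x * (w - y) / ((x + y) * (x + w))" .
  moreover have "0 < (x + y) * (x + w)"
    using assms by simp
  ultimately show ?thesis
    by (simp add: pos_divide_le_eq)
qed

lemma scarf_excess_demand_nth:
  "scarf_excess_demand p $ 1 = p$1 / (p$1 + p$2) + p$3 / (p$1 + p$3) - 1"
  "scarf_excess_demand p $ 2 = p$1 / (p$1 + p$2) + p$2 / (p$2 + p$3) - 1"
  "scarf_excess_demand p $ 3 = p$2 / (p$2 + p$3) + p$3 / (p$1 + p$3) - 1"
  by (simp_all add: scarf_excess_demand_def)

lemma scarf_excess_demand_scaleR:
  assumes "c \<noteq> 0"
  shows "scarf_excess_demand (c *\<^sub>R p) = scarf_excess_demand p"
  \<comment> \<open>Factoring \<open>c\<close> out of each denominator lets it cancel, even where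
    the denominator is zero.\<close>
  using assms by (simp add: scarf_excess_demand_def flip: distrib_left)

lemma walras_law_scarf: "walras_law scarf_excess_demand"
  unfolding walras_law_def
proof
  fix p :: "real ^ 3"
  assume "p \<in> nonneg_orthant"
  then have "0 \<le> p $ 1" "0 \<le> p $ 2" "0 \<le> p $ 3"
    by (simp_all add: nonneg_orthant_def)
  \<comment> \<open>The value of excess demand regroups by consumer: the owners of goods 1, 2 and 3
    also buy goods 2, 3 and 1 respectively, and each spends exactly the value of the
    endowment.\<close>
  then show "p \<bullet> scarf_excess_demand p = 0"
    using mult_share_add[of "p$1" "p$2"] mult_share_add[of "p$2" "p$3"]
      mult_share_add[of "p$3" "p$1"]
    by (simp add: inner_vec_def sum_3 scarf_excess_demand_nth distrib_left right_diff_distrib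
        add.commute[of "p$3" "p$1"])
qed

lemma balanced_economy_scarf: "balanced_economy scarf_excess_demand"
  using walras_law_scarf
  by (simp add: balanced_economy_def walras_law_def scarf_excess_demand_scaleR)

lemma equal_prices_if_cyclic_le:
  fixes a b c :: real
  assumes nonneg: "0 \<le> a" "0 \<le> b" "0 \<le> c"
    and dom: "a + b \<noteq> 0" "a + c \<noteq> 0" "b + c \<noteq> 0"
    and le: "a * (c - b) \<le> 0" "b * (a - c) \<le> 0" "c * (b - a) \<le> 0"
  shows "0 < a \<and> b = a \<and> c = a"
proof -
  have "a * (c - b) + b * (a - c) + c * (b - a) = 0"
    by (simp add: algebra_simps)
  then have "a * (c - b) = 0" "b * (a - c) = 0" "c * (b - a) = 0"
    using le by linarith+
  \<comment> \<open>If, say, \<open>a = 0\<close>, the second product gives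
    \<open>b * c = 0\<close>, so \<open>a + b\<close> or \<open>a + c\<close> would vanish. With no
    price zero, the other factors must vanish.\<close>
  then show ?thesis
    using nonneg dom by auto
qed

lemma walrasian_equilibria_scarf:
  "walrasian_equilibria scarf_domain scarf_excess_demand
     = {c *\<^sub>R (vector [1, 1, 1] :: real ^ 3) | c::real. c > 0}"
proof (intro equalityI subsetI)
  fix p
  assume p: "p \<in> walrasian_equilibria scarf_domain scarf_excess_demand"
  then have nonneg: "0 \<le> p $ 1" "0 \<le> p $ 2" "0 \<le> p $ 3"
    and dom: "p$1 + p$2 \<noteq> 0" "p$1 + p$3 \<noteq> 0" "p$2 + p$3 \<noteq> 0"
    and z: "scarf_excess_demand p $ 1 \<le> 0" "scarf_excess_demand p $ 2 \<le> 0"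
      "scarf_excess_demand p $ 3 \<le> 0"
    by (simp_all add: walrasian_equilibria_def nonneg_orthant_def scarf_domain_def)
  have pos: "0 < p$1 + p$2" "0 < p$1 + p$3" "0 < p$2 + p$3"
    using nonneg dom by linarith+
  \<comment> \<open>For each good, \<open>x\<close> is its own price, \<open>y\<close> that of the
    other good its owner buys, and \<open>w\<close> that of the good owned by its other
    buyer.\<close>
  have "p$1 * (p$3 - p$2) \<le> 0" "p$2 * (p$1 - p$3) \<le> 0" "p$3 * (p$2 - p$1) \<le> 0"
    using z pos share_add_le_one_iff[of "p$1" "p$2" "p$3"]
      share_add_le_one_iff[of "p$2" "p$3" "p$1"] share_add_le_one_iff[of "p$3" "p$1" "p$2"]
    by (simp_all add: scarf_excess_demand_nth add.commute)
  then have "0 < p$1 \<and> p$2 = p$1 \<and> p$3 = p$1"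
    using nonneg dom by (intro equal_prices_if_cyclic_le)
  moreover from this have "p = p$1 *\<^sub>R vector [1, 1, 1]"
    by (simp add: vec_eq_iff forall_3)
  ultimately show "p \<in> {c *\<^sub>R (vector [1, 1, 1] :: real ^ 3) | c::real. c > 0}"
    by blast
next
  fix p
  assume "p \<in> {c *\<^sub>R (vector [1, 1, 1] :: real ^ 3) | c::real. c > 0}"
  then obtain c :: real where c: "c > 0" "p = c *\<^sub>R vector [1, 1, 1]"
    by blast
  then have "p \<in> nonneg_orthant" "p \<in> scarf_domain"
    by (simp_all add: nonneg_orthant_def scarf_domain_def forall_3)
  \<comment> \<open>Homogeneity reduces this to the price vector of ones, where each entry is 1/2 +
    1/2 - 1 = 0.\<close>
  moreover have "\<forall>j. scarf_excess_demand p $ j \<le> 0"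
    using c by (simp add: scarf_excess_demand_scaleR forall_3 scarf_excess_demand_nth)
  ultimately show "p \<in> walrasian_equilibria scarf_domain scarf_excess_demand"
    using walras_law_scarf by (simp add: walrasian_equilibria_def walras_law_def)
qed

theorem lemmaD1:
  shows "balanced_economy scarf_excess_demand \<and>
         walras_law scarf_excess_demand \<and>
         walrasian_equilibria scarf_domain scarf_excess_demand
           = {c *\<^sub>R (vector [1, 1, 1] :: real ^ 3) | c::real. c > 0}"
  using balanced_economy_scarf walras_law_scarf walrasian_equilibria_scarf by blast

end
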